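(* Let $(A,\cdot,\delta)$ be a commutative and cocommutative associative D-bialgebra over $K$ and let $f,g:A\to A$ be linear maps. Define $[x,y]_{(f,g)}:=x\cdot f(y)+g(x\cdot y)$ and $\Delta_{(g,f)}(x):=x_{[1]}\otimes g(x_{[2]})+f(x)_{[1]}\otimes f(x)_{[2]}$. Then $(A,[,]_{(f,g)},\Delta_{(g,f)})$ is a left Alia bialgebra.
   Context: All vector spaces are over a field $K$ of characteristic zero. Sweedler notation without summation sign: $\delta(x)=x_{[1]}\otimes x_{[2]}$, $\Delta(x)=x_{(1)}\otimes x_{(2)}$; e.g. $f(x)_{[1]}\otimes f(x)_{[2]}=\delta(f(x))$. $\tau$ is the flip map on $A\otimes A$. No unit or counit is assumed. A commutative and cocommutative associative D-bialgebra is a triple $(A,\cdot,\delta)$ where $(A,\cdot)$ is a commutative associative algebra, $(A,\delta)$ is a cocommutative coassociative coalgebra and $\delta(a\cdot b)=a_{[1]}\cdot b\otimes a_{[2]}+b_{[1]}\otimes a\cdot b_{[2]}$ for all $a,b\in A$. A left Alia algebra is a vector space $A$ with bilinear $[,]$ satisfying $[[x,y],z]+[[y,z],x]+[[z,x],y]=[[y,x],z]+[[z,y],x]+[[x,z],y]$. A left Alia coalgebra is $(A,\Delta)$, $\Delta:A\to A\otimes A$ linear, with $$x_{(1)(2)}\otimes x_{(1)(1)}\otimes x_{(2)}+x_{(1)(1)}\otimes x_{(2)}\otimes x_{(1)(2)}+x_{(2)}\otimes x_{(1)(2)}\otimes x_{(1)(1)}=x_{(1)(1)}\otimes x_{(1)(2)}\otimes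 x_{(2)}+x_{(1)(2)}\otimes x_{(2)}\otimes x_{(1)(1)}+x_{(2)}\otimes x_{(1)(1)}\otimes x_{(1)(2)},$$ where $x_{(1)(1)}\otimes x_{(1)(2)}\otimes x_{(2)}=(\Delta\otimes\mathrm{id})\Delta(x)$. A left Alia bialgebra is a triple $(A,[,],\Delta)$ with $(A,[,])$ a left Alia algebra, $(A,\Delta)$ a left Alia coalgebra and, for all $x,y\in A$, $$(\tau-\mathrm{id}^{\otimes 2})\big(\Delta([x,y]-[y,x])\big)=(\tau-\mathrm{id}^{\otimes 2})\big((\mathcal R(y)\otimes\mathrm{id})\Delta(x)-(\mathcal R(x)\otimes\mathrm{id})\Delta(y)\big),$$ where $\mathcal R(y)z=[z,y]$. *)

theory Defs
  imports Complex_Main "HOL-Library.Function_Algebras"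
begin

section \<open>Tensor powers of a vector space\<close>

text \<open>
  Vector spaces are given by a scalar multiplication \<open>s :: 'k \<Rightarrow> 'a \<Rightarrow> 'a\<close>, as in the locale
  \<^locale>\<open>vector_space\<close>. The tensor product of \<open>A\<close> with itself is the image of the free
  vector space on \<open>A \<times> A\<close> under the map sending the generator \<open>(x, y)\<close> to the functional
  \<open>\<beta> \<mapsto> \<beta> x y\<close> on bilinear forms. Over a field the kernel of this map is the subspace generated
  by the usual bilinearity relations, so this is the usual quotient; the universal property is
  proved below. Similarly for the triple tensor product, with trilinear forms.
  Addition and subtraction of tensors are pointwise.
\<close>

type_synonym ('a, 'k) tens2 = "('a \<Rightarrow> 'a \<Rightarrow> 'k) \<Rightarrow> 'k"
type_synonym ('a, 'k) tens3 = "('a \<Rightarrow> 'a \<Rightarrow> 'a \<Rightarrow> 'k) \<Rightarrow> 'k"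

definition fscale :: "'k::field \<Rightarrow> ('x \<Rightarrow> 'k) \<Rightarrow> 'x \<Rightarrow> 'k" where
  "fscale c t = (\<lambda>\<beta>. c * t \<beta>)"

definition bilinear_map ::
  "('k::field \<Rightarrow> 'a::ab_group_add \<Rightarrow> 'a) \<Rightarrow> ('k \<Rightarrow> 'v::ab_group_add \<Rightarrow> 'v) \<Rightarrow> ('a \<Rightarrow> 'a \<Rightarrow> 'v) \<Rightarrow> bool"
  where
  "bilinear_map s t h \<longleftrightarrow>
     (\<forall>y. Vector_Spaces.linear s t (\<lambda>x. h x y)) \<and>
     (\<forall>x. Vector_Spaces.linear s t (\<lambda>y. h x y))"

definition trilinear_map ::
  "('k::field \<Rightarrow> 'a::ab_group_add \<Rightarrow> 'a) \<Rightarrow> ('k \<Rightarrow> 'v::ab_group_add \<Rightarrow> 'v) \<Rightarrow> ('a \<Rightarrow> 'a \<Rightarrow> 'a \<Rightarrow> 'v) \<Rightarrow> bool"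
  where
  "trilinear_map s t h \<longleftrightarrow>
     (\<forall>y z. Vector_Spaces.linear s t (\<lambda>x. h x y z)) \<and>
     (\<forall>x z. Vector_Spaces.linear s t (\<lambda>y. h x y z)) \<and>
     (\<forall>x y. Vector_Spaces.linear s t (\<lambda>z. h x y z))"

text \<open>Tensors are set to \<open>0\<close> on functions that are not multilinear, so that equality of tensors
  is equality of functions.\<close>

definition tensor2 :: "('k::field \<Rightarrow> 'a::ab_group_add \<Rightarrow> 'a) \<Rightarrow> 'a \<Rightarrow> 'a \<Rightarrow> ('a, 'k) tens2" where
  "tensor2 s x y = (\<lambda>\<beta>. if bilinear_map s (*) \<beta> then \<beta> x y else 0)"

definition tensor3 :: "('k::field \<Rightarrow> 'a::ab_group_add \<Rightarrow> 'a) \<Rightarrow> 'a \<Rightarrow> 'a \<Rightarrow> 'a \<Rightarrow> ('a, 'k) tens3" where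
  "tensor3 s x y z = (\<lambda>\<beta>. if trilinear_map s (*) \<beta> then \<beta> x y z else 0)"

definition tensor2_space :: "('k::field \<Rightarrow> 'a::ab_group_add \<Rightarrow> 'a) \<Rightarrow> ('a, 'k) tens2 set" where
  "tensor2_space s = module.span fscale {tensor2 s x y | x y. True}"

definition tensor3_space :: "('k::field \<Rightarrow> 'a::ab_group_add \<Rightarrow> 'a) \<Rightarrow> ('a, 'k) tens3 set" where
  "tensor3_space s = module.span fscale {tensor3 s x y z | x y z. True}"

text \<open>
  Sweedler substitution: if \<open>t\<close> is the sum of the simple tensors \<open>x\<^sub>i \<otimes> y\<^sub>i\<close> and \<open>h\<close> is a bilinear
  map into a tensor space, then \<open>sweedler2 h t\<close> is the sum of the \<open>h x\<^sub>i y\<^sub>i\<close>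
  (see \<open>sweedler2_tensor2\<close> below).
\<close>

definition sweedler2 :: "('a \<Rightarrow> 'a \<Rightarrow> ('x \<Rightarrow> 'k)) \<Rightarrow> ('a, 'k) tens2 \<Rightarrow> ('x \<Rightarrow> 'k)" where
  "sweedler2 h t = (\<lambda>\<gamma>. t (\<lambda>x y. h x y \<gamma>))"

definition sweedler3 :: "('a \<Rightarrow> 'a \<Rightarrow> 'a \<Rightarrow> ('x \<Rightarrow> 'k)) \<Rightarrow> ('a, 'k) tens3 \<Rightarrow> ('x \<Rightarrow> 'k)" where
  "sweedler3 h t = (\<lambda>\<gamma>. t (\<lambda>x y z. h x y z \<gamma>))"

definition tensor_map ::
  "('k::field \<Rightarrow> 'a::ab_group_add \<Rightarrow> 'a) \<Rightarrow> ('a \<Rightarrow> 'a) \<Rightarrow> ('a \<Rightarrow> 'a) \<Rightarrow> ('a, 'k) tens2 \<Rightarrow> ('a, 'k) tens2"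
  where
  "tensor_map s f g = sweedler2 (\<lambda>x y. tensor2 s (f x) (g y))"

definition tensor_flip ::
  "('k::field \<Rightarrow> 'a::ab_group_add \<Rightarrow> 'a) \<Rightarrow> ('a, 'k) tens2 \<Rightarrow> ('a, 'k) tens2" where
  "tensor_flip s = sweedler2 (\<lambda>x y. tensor2 s y x)"

text \<open>\<open>comult_left s \<Delta>\<close> is \<open>\<Delta> \<otimes> id\<close> and \<open>comult_right s \<Delta>\<close> is \<open>id \<otimes> \<Delta>\<close>.\<close>

definition comult_left ::
  "('k::field \<Rightarrow> 'a::ab_group_add \<Rightarrow> 'a) \<Rightarrow> ('a \<Rightarrow> ('a, 'k) tens2) \<Rightarrow> ('a, 'k) tens2 \<Rightarrow> ('a, 'k) tens3"
  where
  "comult_left s \<Delta> = sweedler2 (\<lambda>x z. sweedler2 (\<lambda>u v. tensor3 s u v z) (\<Delta> x))"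

definition comult_right ::
  "('k::field \<Rightarrow> 'a::ab_group_add \<Rightarrow> 'a) \<Rightarrow> ('a \<Rightarrow> ('a, 'k) tens2) \<Rightarrow> ('a, 'k) tens2 \<Rightarrow> ('a, 'k) tens3"
  where
  "comult_right s \<Delta> = sweedler2 (\<lambda>x z. sweedler2 (\<lambda>u v. tensor3 s x u v) (\<Delta> z))"


subsection \<open>Universal property\<close>

lemma vector_space_fscale: "vector_space (fscale :: 'k::field \<Rightarrow> ('x \<Rightarrow> 'k) \<Rightarrow> 'x \<Rightarrow> 'k)"
  by unfold_locales (auto simp: fscale_def fun_eq_iff algebra_simps)

lemma vector_space_self: "vector_space ((*) :: 'k::field \<Rightarrow> 'k \<Rightarrow> 'k)"
  by unfold_locales (auto simp: algebra_simps)

lemma linear_fscale_apply: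
  assumes "Vector_Spaces.linear s fscale h"
  shows "Vector_Spaces.linear s (*) (\<lambda>x. h x \<gamma>)"
  using assms vector_space_self
  by (auto simp: Vector_Spaces.linear_iff fscale_def)

lemma linear_to_fscaleI:
  assumes "vector_space s" "\<And>\<gamma>. Vector_Spaces.linear s (*) (\<lambda>x. h x \<gamma>)"
  shows "Vector_Spaces.linear s fscale h"
  using assms vector_space_fscale
  by (auto simp: Vector_Spaces.linear_iff fscale_def fun_eq_iff)

lemma linear_zero_form:
  "vector_space s \<Longrightarrow> Vector_Spaces.linear s (*) (\<lambda>x. 0 :: 'k::field)"
  using vector_space_self by (auto simp: Vector_Spaces.linear_iff)

lemma linear_if_form:
  assumes "vector_space s" "P \<Longrightarrow> Vector_Spaces.linear s (*) h"
  shows "Vector_Spaces.linear s (*) (\<lambda>x. if P then h x else 0)"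
  using assms linear_zero_form by (cases P) auto

lemma bilinear_tensor2:
  assumes "vector_space s"
  shows "bilinear_map s fscale (tensor2 s)"
  unfolding bilinear_map_def tensor2_def
  by (intro conjI allI linear_to_fscaleI linear_if_form assms) (simp_all add: bilinear_map_def)

lemma trilinear_tensor3:
  assumes "vector_space s"
  shows "trilinear_map s fscale (tensor3 s)"
  unfolding trilinear_map_def tensor3_def
  by (intro conjI allI linear_to_fscaleI linear_if_form assms) (simp_all add: trilinear_map_def)

lemma sweedler2_tensor2:
  assumes "bilinear_map s fscale h"
  shows "sweedler2 h (tensor2 s x y) = h x y"
proof -
  have "bilinear_map s (*) (\<lambda>x y. h x y \<gamma>)" for \<gamma>
    using assms unfolding bilinear_map_def
    by (intro conjI allI linear_fscale_apply[where \<gamma> = \<gamma>]) simp_all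
  then show ?thesis by (simp add: sweedler2_def tensor2_def)
qed

lemma sweedler3_tensor3:
  assumes "trilinear_map s fscale h"
  shows "sweedler3 h (tensor3 s x y z) = h x y z"
proof -
  have "trilinear_map s (*) (\<lambda>x y z. h x y z \<gamma>)" for \<gamma>
    using assms unfolding trilinear_map_def
    by (intro conjI allI linear_fscale_apply[where \<gamma> = \<gamma>]) simp_all
  then show ?thesis by (simp add: sweedler3_def tensor3_def)
qed

lemma linear_sweedler2: "Vector_Spaces.linear fscale fscale (sweedler2 h)"
  by (simp add: Vector_Spaces.linear_iff vector_space_fscale)
     (simp add: fscale_def sweedler2_def fun_eq_iff)

lemma linear_sweedler3: "Vector_Spaces.linear fscale fscale (sweedler3 h)"
  by (simp add: Vector_Spaces.linear_iff vector_space_fscale)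
     (simp add: fscale_def sweedler3_def fun_eq_iff)

lemma linear_factor_evaluation:
  fixes e :: "'p \<Rightarrow> 'x \<Rightarrow> 'k::field" and h :: "'p \<Rightarrow> 'v::ab_group_add"
  assumes t: "vector_space t"
    and e: "\<And>\<phi>. Vector_Spaces.linear t (*) \<phi> \<Longrightarrow> \<exists>\<gamma>. \<forall>p. e p \<gamma> = \<phi> (h p)"
  shows "\<exists>L. Vector_Spaces.linear fscale t L \<and> (\<forall>p. L (e p) = h p)"
proof -
  interpret F: vector_space "fscale :: 'k \<Rightarrow> ('x \<Rightarrow> 'k) \<Rightarrow> 'x \<Rightarrow> 'k" by (rule vector_space_fscale)
  interpret T: vector_space t by (rule t)
  interpret K: vector_space "(*) :: 'k \<Rightarrow> 'k \<Rightarrow> 'k" by (rule vector_space_self)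
  interpret FT: vector_space_pair "fscale :: 'k \<Rightarrow> ('x \<Rightarrow> 'k) \<Rightarrow> 'x \<Rightarrow> 'k" t ..
  interpret FK: vector_space_pair "fscale :: 'k \<Rightarrow> ('x \<Rightarrow> 'k) \<Rightarrow> 'x \<Rightarrow> 'k" "(*)" ..
  interpret TK: vector_space_pair t "(*)" ..
  obtain B where B: "B \<subseteq> range e" "F.independent B" "range e \<subseteq> F.span B"
    by (rule F.maximal_independent_subset)
  define q where "q b = (SOME p. e p = b)" for b
  have q: "e (q b) = b" if "b \<in> B" for b
    unfolding q_def using B(1) that by (intro someI_ex[of "\<lambda>p. e p = b"]) auto
  obtain L where L: "Vector_Spaces.linear fscale t L" "\<And>b. b \<in> B \<Longrightarrow> L b = h (q b)"
    using FT.linear_independent_extend[OF B(2), of "\<lambda>b. h (q b)"] by blast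
  have eq: "\<phi> (L (e p)) = \<phi> (h p)" if \<phi>: "Vector_Spaces.linear t (*) \<phi>" for \<phi> p
  proof -
    obtain \<gamma> where \<gamma>: "\<And>p. e p \<gamma> = \<phi> (h p)" using e[OF \<phi>] by blast
    have 1: "Vector_Spaces.linear fscale (*) (\<lambda>u. \<phi> (L u))"
      using Vector_Spaces.linear_compose[OF L(1) \<phi>] by (simp add: o_def)
    have 2: "Vector_Spaces.linear fscale (*) (\<lambda>u :: 'x \<Rightarrow> 'k. u \<gamma>)"
      using F.vector_space_axioms K.vector_space_axioms
      by (auto simp: Vector_Spaces.linear_iff fscale_def)
    have "\<phi> (L (e p)) = e p \<gamma>"
    proof (rule FK.linear_eq_on[OF 1 2])
      show "e p \<in> F.span B" using B(3) by blast
      show "\<phi> (L b) = b \<gamma>" if "b \<in> B" for b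
        using L(2)[OF that] q[OF that] \<gamma>[of "q b"] by simp
    qed
    then show ?thesis by (simp add: \<gamma>)
  qed
  have "L (e p) = h p" for p
  proof (rule ccontr)
    assume "L (e p) \<noteq> h p"
    then have "T.independent {L (e p) - h p}"
      by (simp add: T.dependent_single)
    from TK.linear_independent_extend[OF this, of "\<lambda>_. 1"]
    obtain \<phi> where \<phi>: "Vector_Spaces.linear t (*) \<phi>" "\<phi> (L (e p) - h p) = 1" by auto
    have "\<phi> (L (e p) - h p) = \<phi> (L (e p)) - \<phi> (h p)"
      by (rule TK.linear_diff[OF \<phi>(1)])
    with \<phi> eq[OF \<phi>(1), of p] show False by simp
  qed
  with L(1) show ?thesis by blast
qed

text \<open>The factorisations are unique on \<^const>\<open>tensor2_space\<close> and \<^const>\<open>tensor3_space\<close>, which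
  are spanned by the simple tensors.\<close>

theorem tensor2_universal:
  assumes "vector_space t" "bilinear_map s t h"
  shows "\<exists>L. Vector_Spaces.linear fscale t L \<and> (\<forall>x y. L (tensor2 s x y) = h x y)"
proof -
  have "\<exists>L. Vector_Spaces.linear fscale t L \<and>
    (\<forall>p. L ((\<lambda>(x, y). tensor2 s x y) p) = (\<lambda>(x, y). h x y) p)"
  proof (rule linear_factor_evaluation[OF assms(1)])
    fix \<phi> :: "'b \<Rightarrow> 'a" assume "Vector_Spaces.linear t (*) \<phi>"
    then have "bilinear_map s (*) (\<lambda>x y. \<phi> (h x y))"
      using assms(2) Vector_Spaces.linear_compose[of s t _ "(*)" \<phi>]
      by (simp add: bilinear_map_def o_def)
    then show "\<exists>\<gamma>. \<forall>p. (\<lambda>(x, y). tensor2 s x y) p \<gamma> = \<phi> ((\<lambda>(x, y). h x y) p)"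
      by (intro exI[of _ "\<lambda>x y. \<phi> (h x y)"]) (auto simp: tensor2_def)
  qed
  then show ?thesis by auto
qed

theorem tensor3_universal:
  assumes "vector_space t" "trilinear_map s t h"
  shows "\<exists>L. Vector_Spaces.linear fscale t L \<and> (\<forall>x y z. L (tensor3 s x y z) = h x y z)"
proof -
  have "\<exists>L. Vector_Spaces.linear fscale t L \<and>
    (\<forall>p. L ((\<lambda>(x, y, z). tensor3 s x y z) p) = (\<lambda>(x, y, z). h x y z) p)"
  proof (rule linear_factor_evaluation[OF assms(1)])
    fix \<phi> :: "'b \<Rightarrow> 'a" assume "Vector_Spaces.linear t (*) \<phi>"
    then have "trilinear_map s (*) (\<lambda>x y z. \<phi> (h x y z))"
      using assms(2) Vector_Spaces.linear_compose[of s t _ "(*)" \<phi>]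
      by (simp add: trilinear_map_def o_def)
    then show "\<exists>\<gamma>. \<forall>p. (\<lambda>(x, y, z). tensor3 s x y z) p \<gamma> = \<phi> ((\<lambda>(x, y, z). h x y z) p)"
      by (intro exI[of _ "\<lambda>x y z. \<phi> (h x y z)"]) (auto simp: tensor3_def)
  qed
  then show ?thesis by auto
qed


section \<open>Algebras, coalgebras and bialgebras\<close>

locale algebra_product = vector_space scale
  for scale :: "'k::field \<Rightarrow> 'a::ab_group_add \<Rightarrow> 'a" +
  fixes mult :: "'a \<Rightarrow> 'a \<Rightarrow> 'a"
  assumes bilinear_mult: "bilinear_map scale scale mult"

locale coalgebra_coproduct = vector_space scale
  for scale :: "'k::field \<Rightarrow> 'a::ab_group_add \<Rightarrow> 'a" +
  fixes \<Delta> :: "'a \<Rightarrow> ('a, 'k) tens2"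
  assumes coproduct_in_tensor2: "\<Delta> x \<in> tensor2_space scale"
    and linear_coproduct: "Vector_Spaces.linear scale fscale \<Delta>"

locale comm_assoc_algebra = algebra_product scale mult
  for scale :: "'k::field \<Rightarrow> 'a::ab_group_add \<Rightarrow> 'a" and mult +
  assumes mult_assoc: "mult (mult x y) z = mult x (mult y z)"
    and mult_commute: "mult x y = mult y x"

locale cocomm_coassoc_coalgebra = coalgebra_coproduct scale \<delta>
  for scale :: "'k::field \<Rightarrow> 'a::ab_group_add \<Rightarrow> 'a" and \<delta> +
  assumes coassoc: "comult_left scale \<delta> (\<delta> x) = comult_right scale \<delta> (\<delta> x)"
    and cocomm: "tensor_flip scale (\<delta> x) = \<delta> x"

locale comm_cocomm_assoc_D_bialgebra =
  comm_assoc_algebra scale mult + cocomm_coassoc_coalgebra scale \<delta>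
  for scale :: "'k::field \<Rightarrow> 'a::ab_group_add \<Rightarrow> 'a" and mult and \<delta> +
  assumes D_compat:
    "\<delta> (mult a b) = sweedler2 (\<lambda>a1 a2. tensor2 scale (mult a1 b) a2) (\<delta> a)
                   + sweedler2 (\<lambda>b1 b2. tensor2 scale b1 (mult a b2)) (\<delta> b)"

locale left_alia_algebra = algebra_product scale br
  for scale :: "'k::field \<Rightarrow> 'a::ab_group_add \<Rightarrow> 'a" and br +
  assumes left_alia:
    "br (br x y) z + br (br y z) x + br (br z x) y = br (br y x) z + br (br z y) x + br (br x z) y"

text \<open>In the axiom below, \<open>u \<otimes> v \<otimes> w\<close> stands for
  \<open>x\<^bsub>(1)(1)\<^esub> \<otimes> x\<^bsub>(1)(2)\<^esub> \<otimes> x\<^bsub>(2)\<^esub> = (\<Delta> \<otimes> id) (\<Delta> x)\<close>.\<close>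

locale left_alia_coalgebra = coalgebra_coproduct scale \<Delta>
  for scale :: "'k::field \<Rightarrow> 'a::ab_group_add \<Rightarrow> 'a" and \<Delta> +
  assumes left_coalia:
    "sweedler3 (\<lambda>u v w. tensor3 scale v u w) (comult_left scale \<Delta> (\<Delta> x))
     + sweedler3 (\<lambda>u v w. tensor3 scale u w v) (comult_left scale \<Delta> (\<Delta> x))
     + sweedler3 (\<lambda>u v w. tensor3 scale w v u) (comult_left scale \<Delta> (\<Delta> x))
     = sweedler3 (\<lambda>u v w. tensor3 scale u v w) (comult_left scale \<Delta> (\<Delta> x))
     + sweedler3 (\<lambda>u v w. tensor3 scale v w u) (comult_left scale \<Delta> (\<Delta> x))
     + sweedler3 (\<lambda>u v w. tensor3 scale w u v) (comult_left scale \<Delta> (\<Delta> x))"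

locale left_alia_bialgebra =
  left_alia_algebra scale br + left_alia_coalgebra scale \<Delta>
  for scale :: "'k::field \<Rightarrow> 'a::ab_group_add \<Rightarrow> 'a" and br and \<Delta> +
  assumes alia_compat:
    "(let D = (\<lambda>t. tensor_flip scale t - t)
      in D (\<Delta> (br x y - br y x))
         = D (tensor_map scale (\<lambda>z. br z y) id (\<Delta> x) - tensor_map scale (\<lambda>z. br z x) id (\<Delta> y)))"

end

theory Submission
  imports Defs
begin

text \<open>
  A tensor is determined by its values on multilinear forms, so every identity of tensors below is
  tested on an arbitrary form. On such a form the twisted coproduct \<open>\<Delta>\<close> is
  \<open>\<Delta> x \<beta> = \<delta> x (\<lambda>a b. \<beta> a (g b)) + \<delta> (f x) \<beta>\<close> (\<open>alia_coproduct_apply\<close>), and applying a tensor to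
  a form is Sweedler notation: \<open>\<delta> x (\<lambda>a b. \<beta> a b)\<close> is \<open>\<beta>(x\<^sub>[\<^sub>1\<^sub>], x\<^sub>[\<^sub>2\<^sub>])\<close>.

  Algebra. Commutativity gives \<open>[x, y] - [y, x] = x \<cdot> f y - y \<cdot> f x\<close>. Bracketing with \<open>z\<close> produces
  \<open>x \<cdot> f y \<cdot> f z - y \<cdot> f x \<cdot> f z\<close> and \<open>g\<close> applied to \<open>x \<cdot> f y \<cdot> z - y \<cdot> f x \<cdot> z\<close>; both cancel in the
  cyclic sum (\<open>left_alia_algebra_bracket\<close>).

  Coalgebra. Cocommutativity and coassociativity make the threefold coproduct of \<open>\<delta>\<close> invariant
  under all permutations of its factors. Evaluated on a trilinear \<open>\<gamma>\<close>, the tensor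
  \<open>(\<Delta> \<otimes> id) (\<Delta> x)\<close> splits into a part where \<open>g\<close> sits on the factors 2 and 3, a part where it sits
  on factor 2 only, and a rest whose inner coproduct is \<open>\<delta>\<close> of a value of \<open>f\<close>. These are
  invariant under exchanging the factors 2 and 3, the factors 1 and 3, and the factors 1 and 2,
  respectively. The coalgebra axiom says that the sums over the odd and over the even permutations
  of the factors agree, and a transposition matches the odd with the even permutations
  (\<open>left_alia_coalgebra_coproduct\<close>).

  Compatibility. Comparing \<open>\<delta> (x \<cdot> y)\<close> with \<open>\<delta> (y \<cdot> x)\<close> shows that
  \<open>\<beta>(x\<^sub>[\<^sub>1\<^sub>] \<cdot> y, x\<^sub>[\<^sub>2\<^sub>]) - \<beta>(x\<^sub>[\<^sub>1\<^sub>], x\<^sub>[\<^sub>2\<^sub>] \<cdot> y)\<close> is symmetric in \<open>x\<close> and \<open>y\<close>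
  (\<open>coproduct_mult_exchange\<close>). Once both sides of the compatibility condition are expanded, the terms
  with exactly one \<open>g\<close> agree by cocommutativity, those with two \<open>g\<close> cancel by this symmetry for \<open>x, y\<close>
  and the form \<open>\<beta>(g _, g _)\<close>, and those without \<open>g\<close> cancel by the symmetry for \<open>f x, f y\<close> and \<open>\<beta>\<close>
  (\<open>alia_compat_form\<close>).
\<close>

section \<open>Multilinear forms and evaluation of tensors\<close>

lemma bilinear_form_iff:
  "bilinear_map s (*) \<beta> \<longleftrightarrow> vector_space s \<and>
     (\<forall>x x' y. \<beta> (x + x') y = \<beta> x y + \<beta> x' y) \<and> (\<forall>c x y. \<beta> (s c x) y = c * \<beta> x y) \<and>
     (\<forall>x y y'. \<beta> x (y + y') = \<beta> x y + \<beta> x y') \<and> (\<forall>c x y. \<beta> x (s c y) = c * \<beta> x y)"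
  by (auto simp: bilinear_map_def Vector_Spaces.linear_iff vector_space_self)

lemma trilinear_form_iff:
  "trilinear_map s (*) \<gamma> \<longleftrightarrow> (\<forall>z. bilinear_map s (*) (\<lambda>x y. \<gamma> x y z)) \<and>
     (\<forall>x. bilinear_map s (*) (\<lambda>y z. \<gamma> x y z))"
  by (auto simp: trilinear_map_def bilinear_map_def)

text \<open>A tensor is a function of arbitrary, not only bilinear, functions of two arguments.
  Bilinearity of both summands is essential for additivity: two functions that are not bilinear
  can have a bilinear sum, while tensors vanish on each of them.\<close>

lemma tensor2_space_add:
  fixes s :: "'k::field \<Rightarrow> 'a::ab_group_add \<Rightarrow> 'a"
  assumes "t \<in> tensor2_space s" "bilinear_map s (*) \<beta>" "bilinear_map s (*) \<gamma>"
  shows "t (\<lambda>x y. \<beta> x y + \<gamma> x y) = t \<beta> + t \<gamma>"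
proof -
  interpret F: vector_space "fscale :: 'k \<Rightarrow> ('a, 'k) tens2 \<Rightarrow> ('a, 'k) tens2"
    by (rule vector_space_fscale)
  have sum: "bilinear_map s (*) (\<lambda>x y. \<beta> x y + \<gamma> x y)"
    using assms(2,3) by (simp add: bilinear_form_iff algebra_simps)
  show ?thesis
    using assms(1) unfolding tensor2_space_def
  proof (induction rule: F.span_induct)
    case base
    then show ?case
      by (auto intro!: F.subspaceI simp: fscale_def algebra_simps)
  next
    case (step t)
    then show ?case
      using assms(2,3) sum by (auto simp: tensor2_def)
  qed
qed

lemma tensor2_space_scale:
  fixes s :: "'k::field \<Rightarrow> 'a::ab_group_add \<Rightarrow> 'a"
  assumes "t \<in> tensor2_space s" "bilinear_map s (*) \<beta>"
  shows "t (\<lambda>x y. c * \<beta> x y) = c * t \<beta>"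
proof -
  interpret F: vector_space "fscale :: 'k \<Rightarrow> ('a, 'k) tens2 \<Rightarrow> ('a, 'k) tens2"
    by (rule vector_space_fscale)
  have mult: "bilinear_map s (*) (\<lambda>x y. c * \<beta> x y)"
    using assms(2) by (simp add: bilinear_form_iff algebra_simps)
  show ?thesis
    using assms(1) unfolding tensor2_space_def
  proof (induction rule: F.span_induct)
    case base
    then show ?case
      by (auto intro!: F.subspaceI simp: fscale_def algebra_simps)
  next
    case (step t)
    then show ?case
      using assms(2) mult by (auto simp: tensor2_def)
  qed
qed

lemma tensor2_space_not_bilinear:
  fixes s :: "'k::field \<Rightarrow> 'a::ab_group_add \<Rightarrow> 'a"
  assumes "t \<in> tensor2_space s" "\<not> bilinear_map s (*) \<beta>"
  shows "t \<beta> = 0"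
proof -
  interpret F: vector_space "fscale :: 'k \<Rightarrow> ('a, 'k) tens2 \<Rightarrow> ('a, 'k) tens2"
    by (rule vector_space_fscale)
  show ?thesis
    using assms(1) unfolding tensor2_space_def
  proof (induction rule: F.span_induct)
    case base
    then show ?case
      by (auto intro!: F.subspaceI simp: fscale_def)
  next
    case (step t)
    then show ?case
      using assms(2) by (auto simp: tensor2_def)
  qed
qed

lemma tensor2_space_zero_form:
  fixes s :: "'k::field \<Rightarrow> 'a::ab_group_add \<Rightarrow> 'a"
  assumes "t \<in> tensor2_space s"
  shows "t (\<lambda>x y. 0) = 0"
proof (cases "bilinear_map s (*) (\<lambda>x y. 0)")
  case True
  from tensor2_space_scale[OF assms True, of 0] show ?thesis by simp
qed (rule tensor2_space_not_bilinear[OF assms])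

lemma sweedler2_in_tensor2_space:
  fixes s :: "'k::field \<Rightarrow> 'a::ab_group_add \<Rightarrow> 'a"
  assumes t: "t \<in> tensor2_space s"
    and h: "bilinear_map s fscale h" "\<And>x y. h x y \<in> tensor2_space s"
  shows "sweedler2 h t \<in> tensor2_space s"
proof -
  interpret F: vector_space "fscale :: 'k \<Rightarrow> ('a, 'k) tens2 \<Rightarrow> ('a, 'k) tens2"
    by (rule vector_space_fscale)
  interpret L: Vector_Spaces.linear
    "fscale :: 'k \<Rightarrow> ('a, 'k) tens2 \<Rightarrow> ('a, 'k) tens2" fscale "sweedler2 h"
    by (rule linear_sweedler2)
  have "F.subspace (tensor2_space s)"
    unfolding tensor2_space_def by (rule F.subspace_span)
  then have "F.subspace {t. sweedler2 h t \<in> tensor2_space s}"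
    using L.subspace_vimage by (simp add: vimage_def)
  with t show ?thesis
    unfolding tensor2_space_def[of s]
    by (rule F.span_induct) (use h sweedler2_tensor2[OF h(1)] in \<open>auto simp: tensor2_space_def\<close>)
qed

lemma tensor2_in_tensor2_space:
  fixes s :: "'k::field \<Rightarrow> 'a::ab_group_add \<Rightarrow> 'a"
  shows "tensor2 s x y \<in> tensor2_space s"
proof -
  interpret F: vector_space "fscale :: 'k \<Rightarrow> ('a, 'k) tens2 \<Rightarrow> ('a, 'k) tens2"
    by (rule vector_space_fscale)
  show ?thesis unfolding tensor2_space_def by (rule F.span_base) blast
qed

context coalgebra_coproduct
begin

lemma coproduct_add: "\<Delta> (x + y) \<beta> = \<Delta> x \<beta> + \<Delta> y \<beta>"
  using linear_coproduct by (simp add: Vector_Spaces.linear_iff)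

lemma coproduct_scale: "\<Delta> (scale c x) \<beta> = c * \<Delta> x \<beta>"
  using linear_coproduct by (simp add: Vector_Spaces.linear_iff fscale_def)

lemma coproduct_diff: "\<Delta> (x - y) \<beta> = \<Delta> x \<beta> - \<Delta> y \<beta>"
  using coproduct_add[of "x - y" y] by (simp add: algebra_simps)

lemmas coproduct_add_form = tensor2_space_add[OF coproduct_in_tensor2]
lemmas coproduct_scale_form = tensor2_space_scale[OF coproduct_in_tensor2]
lemmas coproduct_zero_form = tensor2_space_zero_form[OF coproduct_in_tensor2]

text \<open>Makes the inner evaluation in \<open>(\<Delta> \<otimes> id) (\<Delta> x)\<close> an admissible argument of the outer one. The map
  \<open>h\<close> accounts for the summand \<open>\<delta> (f a)\<close> of the twisted coproduct.\<close>

lemma bilinear_coproduct_left: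
  assumes h: "Vector_Spaces.linear scale scale h" and \<gamma>: "trilinear_map scale (*) \<gamma>"
  shows "bilinear_map scale (*) (\<lambda>a c. \<Delta> (h a) (\<lambda>u v. \<gamma> u v c))"
proof -
  have b: "bilinear_map scale (*) (\<lambda>u v. \<gamma> u v c)" for c
    using \<gamma> by (simp add: trilinear_form_iff)
  have "\<Delta> a (\<lambda>u v. \<gamma> u v (c + c')) = \<Delta> a (\<lambda>u v. \<gamma> u v c) + \<Delta> a (\<lambda>u v. \<gamma> u v c')" for a c c'
    using \<gamma> coproduct_add_form[OF b b, of a c c']
    by (simp add: trilinear_form_iff bilinear_form_iff)
  moreover have "\<Delta> a (\<lambda>u v. \<gamma> u v (scale k c)) = k * \<Delta> a (\<lambda>u v. \<gamma> u v c)" for a c k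
    using \<gamma> coproduct_scale_form[OF b, of a k c]
    by (simp add: trilinear_form_iff bilinear_form_iff)
  ultimately show ?thesis
    using h vector_space_axioms
    by (simp add: bilinear_form_iff Vector_Spaces.linear_iff coproduct_add coproduct_scale)
qed

lemma comult_left_apply:
  "comult_left scale \<Delta> (\<Delta> x) \<gamma> = \<Delta> x (\<lambda>a c. \<Delta> a (\<lambda>u v. tensor3 scale u v c \<gamma>))"
  by (simp add: comult_left_def sweedler2_def)

end

context cocomm_coassoc_coalgebra
begin

lemma cocomm_form:
  assumes "bilinear_map scale (*) \<beta>"
  shows "\<delta> x (\<lambda>a b. \<beta> b a) = \<delta> x \<beta>"
  using fun_cong[OF cocomm[of x], of \<beta>] assms
  by (simp add: tensor_flip_def sweedler2_def tensor2_def)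

lemma coassoc_form:
  assumes "trilinear_map scale (*) \<gamma>"
  shows "\<delta> x (\<lambda>a c. \<delta> a (\<lambda>u v. \<gamma> u v c)) = \<delta> x (\<lambda>a c. \<delta> c (\<lambda>u v. \<gamma> a u v))"
  using fun_cong[OF coassoc[of x], of \<gamma>] assms
  by (simp add: comult_left_def comult_right_def sweedler2_def tensor3_def)

text \<open>The value of \<open>(\<delta> \<otimes> id) (\<delta> x)\<close> on a trilinear form.\<close>

abbreviation coproduct3 :: "'a \<Rightarrow> ('a \<Rightarrow> 'a \<Rightarrow> 'a \<Rightarrow> 'k) \<Rightarrow> 'k" where
  "coproduct3 x \<gamma> \<equiv> \<delta> x (\<lambda>a c. \<delta> a (\<lambda>u v. \<gamma> u v c))"

text \<open>Cocommutativity of the inner coproduct exchanges the first two factors; coassociativity moves the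
  inner coproduct to the right, where it exchanges the last two. These transpositions generate
  all permutations.\<close>

lemma coproduct3_swap12:
  assumes "trilinear_map scale (*) \<gamma>"
  shows "coproduct3 x (\<lambda>u v w. \<gamma> v u w) = coproduct3 x \<gamma>"
  using assms by (simp add: trilinear_form_iff cocomm_form)

lemma coproduct3_swap23:
  assumes \<gamma>: "trilinear_map scale (*) \<gamma>"
  shows "coproduct3 x (\<lambda>u v w. \<gamma> u w v) = coproduct3 x \<gamma>"
proof -
  have \<gamma>': "trilinear_map scale (*) (\<lambda>u v w. \<gamma> u w v)"
    using \<gamma> by (simp add: trilinear_form_iff bilinear_form_iff)
  have "bilinear_map scale (*) (\<lambda>u v. \<gamma> a u v)" for a
    using \<gamma> by (simp add: trilinear_form_iff)
  then show ?thesis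
    by (simp add: coassoc_form[OF \<gamma>] coassoc_form[OF \<gamma>'] cocomm_form)
qed

lemma coproduct3_swap13:
  assumes \<gamma>: "trilinear_map scale (*) \<gamma>"
  shows "coproduct3 x (\<lambda>u v w. \<gamma> w v u) = coproduct3 x \<gamma>"
proof -
  have 1: "trilinear_map scale (*) (\<lambda>u v w. \<gamma> w u v)" "trilinear_map scale (*) (\<lambda>u v w. \<gamma> v u w)"
    using \<gamma> by (simp_all add: trilinear_form_iff bilinear_form_iff)
  show ?thesis
    using coproduct3_swap12[OF 1(1)] coproduct3_swap23[OF 1(2)] coproduct3_swap12[OF \<gamma>] by simp
qed

end

section \<open>The twisted bracket and coproduct\<close>

definition alia_bracket ::
  "('a \<Rightarrow> 'a \<Rightarrow> 'a::ab_group_add) \<Rightarrow> ('a \<Rightarrow> 'a) \<Rightarrow> ('a \<Rightarrow> 'a) \<Rightarrow> 'a \<Rightarrow> 'a \<Rightarrow> 'a" where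
  "alia_bracket mult f g x y = mult x (f y) + g (mult x y)"

definition alia_coproduct ::
  "('k::field \<Rightarrow> 'a::ab_group_add \<Rightarrow> 'a) \<Rightarrow> ('a \<Rightarrow> ('a, 'k) tens2) \<Rightarrow> ('a \<Rightarrow> 'a) \<Rightarrow> ('a \<Rightarrow> 'a) \<Rightarrow>
    'a \<Rightarrow> ('a, 'k) tens2" where
  "alia_coproduct s \<delta> f g x = sweedler2 (\<lambda>x1 x2. tensor2 s x1 (g x2)) (\<delta> x) + \<delta> (f x)"

lemma (in comm_assoc_algebra) left_alia_algebra_bracket:
  assumes f: "Vector_Spaces.linear scale scale f" and g: "Vector_Spaces.linear scale scale g"
  shows "left_alia_algebra scale (alia_bracket mult f g)"
proof
  have add: "mult (x + x') y = mult x y + mult x' y" "mult x (y + y') = mult x y + mult x y'"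
    "f (x + y) = f x + f y" "g (x + y) = g x + g y" for x x' y y'
    using bilinear_mult f g by (simp_all add: bilinear_map_def Vector_Spaces.linear_iff)
  have scl: "mult (scale c x) y = scale c (mult x y)" "mult x (scale c y) = scale c (mult x y)"
    "f (scale c y) = scale c (f y)" "g (scale c y) = scale c (g y)" for x y c
    using bilinear_mult f g by (simp_all add: bilinear_map_def Vector_Spaces.linear_iff)
  show "bilinear_map scale scale (alia_bracket mult f g)"
    using vector_space_axioms
    by (simp add: bilinear_map_def Vector_Spaces.linear_iff alia_bracket_def add scl
        scale_right_distrib add_ac)
  have left_commute: "mult x (mult y z) = mult y (mult x z)" for x y z
    by (metis mult_assoc mult_commute)
  show "alia_bracket mult f g (alia_bracket mult f g x y) z
      + alia_bracket mult f g (alia_bracket mult f g y z) x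
      + alia_bracket mult f g (alia_bracket mult f g z x) y
    = alia_bracket mult f g (alia_bracket mult f g y x) z
      + alia_bracket mult f g (alia_bracket mult f g z y) x
      + alia_bracket mult f g (alia_bracket mult f g x z) y" for x y z
    by (simp add: alia_bracket_def add mult_assoc mult_commute left_commute add_ac)
qed

context coalgebra_coproduct
begin

lemma alia_coproduct_apply:
  assumes "bilinear_map scale (*) \<beta>"
  shows "alia_coproduct scale \<Delta> f g x \<beta> = \<Delta> x (\<lambda>a b. \<beta> a (g b)) + \<Delta> (f x) \<beta>"
  using assms by (simp add: alia_coproduct_def sweedler2_def tensor2_def)

lemma coalgebra_coproduct_alia:
  assumes f: "Vector_Spaces.linear scale scale f" and g: "Vector_Spaces.linear scale scale g"
  shows "coalgebra_coproduct scale (alia_coproduct scale \<Delta> f g)"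
proof (intro coalgebra_coproduct.intro coalgebra_coproduct_axioms.intro vector_space_axioms)
  interpret F: vector_space "fscale :: 'k \<Rightarrow> ('a, 'k) tens2 \<Rightarrow> ('a, 'k) tens2"
    by (rule vector_space_fscale)
  have bil: "bilinear_map scale fscale (\<lambda>x1 x2. tensor2 scale x1 (g x2))"
    using bilinear_tensor2[OF vector_space_axioms] g
    by (simp add: bilinear_map_def Vector_Spaces.linear_iff)
  show "alia_coproduct scale \<Delta> f g x \<in> tensor2_space scale" for x
    unfolding alia_coproduct_def
    using sweedler2_in_tensor2_space[OF coproduct_in_tensor2 bil tensor2_in_tensor2_space, of x]
      coproduct_in_tensor2[of "f x"]
    unfolding tensor2_space_def by (rule F.span_add)
  show "Vector_Spaces.linear scale fscale (alia_coproduct scale \<Delta> f g)"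
    using linear_coproduct f linear_sweedler2[of "\<lambda>x1 x2. tensor2 scale x1 (g x2)"]
    by (simp add: Vector_Spaces.linear_iff alia_coproduct_def F.scale_right_distrib)
qed

end

context cocomm_coassoc_coalgebra
begin

text \<open>Separates \<open>(\<Delta> \<otimes> id) (\<Delta> x)\<close> into the parts with different symmetry. In the first two, the
  inner coproduct contributes \<open>a\<^sub>[\<^sub>1\<^sub>] \<otimes> g(a\<^sub>[\<^sub>2\<^sub>])\<close>, which leaves a threefold coproduct of \<open>\<delta>\<close>. In the
  bracketed part it contributes \<open>\<delta> (f a)\<close>, so that only the symmetry of that inner \<open>\<delta>\<close> is left.\<close>

lemma alia_coproduct_twice:
  assumes f: "Vector_Spaces.linear scale scale f" and g: "Vector_Spaces.linear scale scale g"
    and \<gamma>: "trilinear_map scale (*) \<gamma>"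
  defines "D \<equiv> alia_coproduct scale \<delta> f g"
  shows "comult_left scale D (D x) \<gamma> =
      coproduct3 x (\<lambda>u v w. \<gamma> u (g v) (g w)) + coproduct3 (f x) (\<lambda>u v w. \<gamma> u (g v) w)
    + (\<delta> x (\<lambda>a c. \<delta> (f a) (\<lambda>u v. \<gamma> u v (g c))) + \<delta> (f x) (\<lambda>a c. \<delta> (f a) (\<lambda>u v. \<gamma> u v c)))"
proof -
  interpret D: coalgebra_coproduct scale D
    unfolding D_def by (rule coalgebra_coproduct_alia[OF f g])
  have id: "Vector_Spaces.linear scale scale (\<lambda>x. x)"
    using vector_space_axioms by (simp add: Vector_Spaces.linear_iff)
  have bil: "bilinear_map scale (*) (\<lambda>u v. \<gamma> u v c)" for c
    using \<gamma> by (simp add: trilinear_form_iff)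
  have tri: "trilinear_map scale (*) (\<lambda>u v w. \<gamma> u (g v) w)"
     "trilinear_map scale (*) (\<lambda>u v w. \<gamma> u (g v) (g w))"
     "trilinear_map scale (*) (\<lambda>u v w. \<gamma> u v (g w))"
    using \<gamma> g by (simp_all add: trilinear_form_iff bilinear_form_iff Vector_Spaces.linear_iff)
  note b1 = bilinear_coproduct_left[OF id tri(1)] bilinear_coproduct_left[OF f \<gamma>]
    bilinear_coproduct_left[OF id tri(2)] bilinear_coproduct_left[OF f tri(3)]
  have "comult_left scale D (D x) \<gamma> = D x (\<lambda>a c. D a (\<lambda>u v. \<gamma> u v c))"
    using \<gamma> by (simp add: D.comult_left_apply tensor3_def)
  also have "\<dots> = \<delta> x (\<lambda>a c. D a (\<lambda>u v. \<gamma> u v (g c))) + \<delta> (f x) (\<lambda>a c. D a (\<lambda>u v. \<gamma> u v c))"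
    using alia_coproduct_apply[OF D.bilinear_coproduct_left[OF id \<gamma>], of f g x]
    by (simp add: D_def)
  also have "\<delta> (f x) (\<lambda>a c. D a (\<lambda>u v. \<gamma> u v c))
      = coproduct3 (f x) (\<lambda>u v w. \<gamma> u (g v) w) + \<delta> (f x) (\<lambda>a c. \<delta> (f a) (\<lambda>u v. \<gamma> u v c))"
    by (simp add: D_def alia_coproduct_apply[OF bil] coproduct_add_form[OF b1(1) b1(2)])
  also have "\<delta> x (\<lambda>a c. D a (\<lambda>u v. \<gamma> u v (g c)))
      = coproduct3 x (\<lambda>u v w. \<gamma> u (g v) (g w)) + \<delta> x (\<lambda>a c. \<delta> (f a) (\<lambda>u v. \<gamma> u v (g c)))"
    by (simp add: D_def alia_coproduct_apply[OF bil] coproduct_add_form[OF b1(3) b1(4)])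
  finally show ?thesis by (simp add: algebra_simps)
qed

text \<open>Each of the parts \<open>P\<close>, \<open>Q\<close>, \<open>R\<close> below is invariant under one transposition of the factors, so its
  values at the three odd permutations of a form are its values at the three even ones.\<close>

lemma left_alia_coalgebra_coproduct:
  assumes f: "Vector_Spaces.linear scale scale f" and g: "Vector_Spaces.linear scale scale g"
  shows "left_alia_coalgebra scale (alia_coproduct scale \<delta> f g)"
proof -
  define D where "D = alia_coproduct scale \<delta> f g"
  interpret D: coalgebra_coproduct scale D
    unfolding D_def by (rule coalgebra_coproduct_alia[OF f g])
  define T where "T x = comult_left scale D (D x)" for x
  define P where "P x \<gamma> = coproduct3 x (\<lambda>u v w. \<gamma> u (g v) (g w))" for x \<gamma>
  define Q where "Q x \<gamma> = coproduct3 (f x) (\<lambda>u v w. \<gamma> u (g v) w)" for x \<gamma>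
  define R where "R x \<gamma> = \<delta> x (\<lambda>a c. \<delta> (f a) (\<lambda>u v. \<gamma> u v (g c)))
    + \<delta> (f x) (\<lambda>a c. \<delta> (f a) (\<lambda>u v. \<gamma> u v c))" for x \<gamma>
  have T: "T x \<gamma> = P x \<gamma> + Q x \<gamma> + R x \<gamma>" if "trilinear_map scale (*) \<gamma>" for x \<gamma>
    unfolding T_def P_def Q_def R_def D_def by (rule alia_coproduct_twice[OF f g that])
  have P: "P x (\<lambda>u v w. \<gamma> u w v) = P x \<gamma>" if "trilinear_map scale (*) \<gamma>" for x \<gamma>
    unfolding P_def using that g
    by (intro coproduct3_swap23[of "\<lambda>u v w. \<gamma> u (g v) (g w)"])
       (simp add: trilinear_form_iff bilinear_form_iff Vector_Spaces.linear_iff)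
  have Q: "Q x (\<lambda>u v w. \<gamma> w v u) = Q x \<gamma>" if "trilinear_map scale (*) \<gamma>" for x \<gamma>
    unfolding Q_def using that g
    by (intro coproduct3_swap13[of "\<lambda>u v w. \<gamma> u (g v) w"])
       (simp add: trilinear_form_iff bilinear_form_iff Vector_Spaces.linear_iff)
  have R: "R x (\<lambda>u v w. \<gamma> v u w) = R x \<gamma>" if "trilinear_map scale (*) \<gamma>" for x \<gamma>
    unfolding R_def using that by (simp add: trilinear_form_iff cocomm_form)
  have main: "T x (\<lambda>u v w. \<gamma> v u w) + T x (\<lambda>u v w. \<gamma> u w v) + T x (\<lambda>u v w. \<gamma> w v u)
      = T x \<gamma> + T x (\<lambda>u v w. \<gamma> v w u) + T x (\<lambda>u v w. \<gamma> w u v)"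
    if \<gamma>: "trilinear_map scale (*) \<gamma>" for x \<gamma>
  proof -
    have perm: "trilinear_map scale (*) (\<lambda>u v w. \<gamma> v u w)"
      "trilinear_map scale (*) (\<lambda>u v w. \<gamma> u w v)" "trilinear_map scale (*) (\<lambda>u v w. \<gamma> w v u)"
      "trilinear_map scale (*) (\<lambda>u v w. \<gamma> v w u)" "trilinear_map scale (*) (\<lambda>u v w. \<gamma> w u v)"
      using \<gamma> by (simp_all add: trilinear_form_iff bilinear_form_iff)
    show ?thesis
      unfolding T[OF \<gamma>] perm[THEN T]
      using P[OF \<gamma>] P[OF perm(1)] P[OF perm(3)] Q[OF \<gamma>] Q[OF perm(1)] Q[OF perm(2)]
        R[OF \<gamma>] R[OF perm(2)] R[OF perm(3)]
      by (simp add: algebra_simps)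
  qed
  have "left_alia_coalgebra scale D"
  proof
    fix x
    show "sweedler3 (\<lambda>u v w. tensor3 scale v u w) (comult_left scale D (D x))
     + sweedler3 (\<lambda>u v w. tensor3 scale u w v) (comult_left scale D (D x))
     + sweedler3 (\<lambda>u v w. tensor3 scale w v u) (comult_left scale D (D x))
     = sweedler3 (\<lambda>u v w. tensor3 scale u v w) (comult_left scale D (D x))
     + sweedler3 (\<lambda>u v w. tensor3 scale v w u) (comult_left scale D (D x))
     + sweedler3 (\<lambda>u v w. tensor3 scale w u v) (comult_left scale D (D x))" (is "?l = ?r")
    proof
      fix \<gamma>
      show "?l \<gamma> = ?r \<gamma>"
      \<comment> \<open>Only multilinear forms carry information: elsewhere both sides are \<open>0\<close>.\<close>
      proof (cases "trilinear_map scale (*) \<gamma>")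
        case True
        then show ?thesis
          using main[OF True, of x] by (simp add: sweedler3_def tensor3_def T_def)
      next
        case False
        then show ?thesis
          by (simp add: sweedler3_def tensor3_def)
      qed
    qed
  qed
  then show ?thesis unfolding D_def .
qed

end

section \<open>Compatibility of bracket and coproduct\<close>

context comm_cocomm_assoc_D_bialgebra
begin

lemma D_compat_form:
  assumes "bilinear_map scale (*) \<beta>"
  shows "\<delta> (mult a b) \<beta> = \<delta> a (\<lambda>p q. \<beta> (mult p b) q) + \<delta> b (\<lambda>p q. \<beta> p (mult a q))"
  using assms by (simp add: D_compat sweedler2_def tensor2_def)

text \<open>The compatibility of \<open>\<delta>\<close> with the product is not visibly symmetric in the two factors, while
  the product is; the difference of the two expansions is the following identity.\<close>

lemma coproduct_mult_exchange:
  assumes "bilinear_map scale (*) \<beta>"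
  shows "\<delta> x (\<lambda>p q. \<beta> (mult p y) q) - \<delta> x (\<lambda>p q. \<beta> p (mult q y))
       = \<delta> y (\<lambda>p q. \<beta> (mult p x) q) - \<delta> y (\<lambda>p q. \<beta> p (mult q x))"
proof -
  have "\<delta> (mult u v) \<beta> = \<delta> u (\<lambda>p q. \<beta> (mult p v) q) + \<delta> v (\<lambda>p q. \<beta> p (mult q u))" for u v
    unfolding D_compat_form[OF assms] by (simp only: mult_commute[of u])
  from this[of x y] this[of y x] show ?thesis
    by (simp add: mult_commute[of y x] algebra_simps)
qed

text \<open>The bialgebra condition on a bilinear form. The twist \<open>\<tau> - id\<close> subtracts the value at \<open>\<beta>\<close> from the
  value at the opposite form, which by cocommutativity removes the
  summand \<open>\<delta> (f z)\<close> of \<open>\<Delta> z\<close>, where \<open>z = [x, y] - [y, x]\<close>.\<close>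

lemma alia_compat_form:
  assumes f: "Vector_Spaces.linear scale scale f" and g: "Vector_Spaces.linear scale scale g"
    and \<beta>: "bilinear_map scale (*) \<beta>"
  defines "D \<equiv> alia_coproduct scale \<delta> f g" and "br \<equiv> alia_bracket mult f g"
  shows "D (br x y - br y x) (\<lambda>a b. \<beta> b a) - D (br x y - br y x) \<beta>
    = (D x (\<lambda>a b. \<beta> b (br a y)) - D y (\<lambda>a b. \<beta> b (br a x)))
      - (D x (\<lambda>a b. \<beta> (br a y) b) - D y (\<lambda>a b. \<beta> (br a x) b))"
proof -
  define z where "z = mult x (f y) - mult y (f x)"
  have bracket: "br x y - br y x = z"
    by (simp add: br_def alia_bracket_def z_def mult_commute[of y x])
  have bil: "bilinear_map scale (*) (\<lambda>a b. \<phi> b a)"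
    "bilinear_map scale (*) (\<lambda>a b. \<phi> (g a) b)" "bilinear_map scale (*) (\<lambda>a b. \<phi> a (g b))"
    "bilinear_map scale (*) (\<lambda>a b. \<phi> (g a) (g b))" if "bilinear_map scale (*) \<phi>" for \<phi>
    using g that by (simp_all add: bilinear_form_iff Vector_Spaces.linear_iff)
  have bil_mult: "bilinear_map scale (*) (\<lambda>a b. \<phi> (mult a u) b)"
    "bilinear_map scale (*) (\<lambda>a b. \<phi> a (mult b u))" if "bilinear_map scale (*) \<phi>" for \<phi> u
    using bilinear_mult that
    unfolding bilinear_form_iff by (simp_all add: bilinear_map_def Vector_Spaces.linear_iff)
  note bil_g = bil(2)[OF \<beta>] bil(3)[OF \<beta>] bil(4)[OF \<beta>]
  have left: "D z (\<lambda>a b. \<beta> b a) - D z \<beta>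
    = \<delta> z (\<lambda>a b. \<beta> (g b) a) - \<delta> z (\<lambda>a b. \<beta> a (g b))"
    unfolding D_def alia_coproduct_apply[OF \<beta>] alia_coproduct_apply[OF bil(1)[OF \<beta>]]
    using cocomm_form[OF \<beta>] by simp
  have z: "\<delta> z \<phi> = \<delta> x (\<lambda>p q. \<phi> (mult p (f y)) q) + \<delta> (f y) (\<lambda>p q. \<phi> p (mult q x))
      - (\<delta> y (\<lambda>p q. \<phi> (mult p (f x)) q) + \<delta> (f x) (\<lambda>p q. \<phi> p (mult q y)))"
    if "bilinear_map scale (*) \<phi>" for \<phi>
    unfolding z_def coproduct_diff D_compat_form[OF that]
    by (simp only: mult_commute[of x] mult_commute[of y])
  have expand: "D x (\<lambda>a b. \<phi> (br a y) b)
    = \<delta> x (\<lambda>a b. \<phi> (mult a (f y)) (g b)) + \<delta> x (\<lambda>a b. \<phi> (g (mult a y)) (g b))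
      + (\<delta> (f x) (\<lambda>a b. \<phi> (mult a (f y)) b) + \<delta> (f x) (\<lambda>a b. \<phi> (g (mult a y)) b))"
    if \<phi>: "bilinear_map scale (*) \<phi>" for \<phi> x y
  proof -
    have *: "bilinear_map scale (*) (\<lambda>a b. \<phi> (mult a (f y)) b + \<phi> (g (mult a y)) b)"
      using bil_mult(1)[OF \<phi>] bil_mult(1)[OF bil(2)[OF \<phi>]]
      by (simp add: bilinear_form_iff algebra_simps)
    have "(\<lambda>a b. \<phi> (br a y) b) = (\<lambda>a b. \<phi> (mult a (f y)) b + \<phi> (g (mult a y)) b)"
      using \<phi> by (simp add: br_def alia_bracket_def bilinear_form_iff)
    then show ?thesis
      by (simp add: D_def alia_coproduct_apply[OF *]
          coproduct_add_form[OF bil_mult(1)[OF bil(3)[OF \<phi>]] bil_mult(1)[OF bil(4)[OF \<phi>]]]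
          coproduct_add_form[OF bil_mult(1)[OF \<phi>] bil_mult(1)[OF bil(2)[OF \<phi>]]])
  qed
  \<comment> \<open>Cocommutativity is used to bring the factor multiplied by \<open>u\<close> into a standard position.\<close>
  have flip: "\<delta> w (\<lambda>p q. \<phi> q (mult p u)) = \<delta> w (\<lambda>p q. \<phi> p (mult q u))"
    if "bilinear_map scale (*) \<phi>" for \<phi> w u
    by (rule cocomm_form[OF bil_mult(2)[OF that]])
  show ?thesis
    unfolding bracket left z[OF bil(3)[OF bil(1)[OF \<beta>]]] z[OF bil_g(2)] expand[OF \<beta>] expand[OF bil(1)[OF \<beta>]]
      flip[OF \<beta>] flip[OF bil_g(1)] flip[OF bil_g(2)] flip[OF bil_g(3)]
      cocomm_form[OF bil_mult(1)[OF bil_g(1)]]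
    \<comment> \<open>The difference of the two sides is that of the sum of two instances of the exchange identity.\<close>
    by (rule diff_eq_diff_eq[THEN iffD2, OF _ arg_cong2[where f = "(+)",
          OF coproduct_mult_exchange[OF bil_g(3), of x y]
            coproduct_mult_exchange[OF \<beta>, of "f x" "f y"]]])
       (simp add: algebra_simps)
qed

lemma left_alia_bialgebra_alia:
  assumes f: "Vector_Spaces.linear scale scale f" and g: "Vector_Spaces.linear scale scale g"
  shows "left_alia_bialgebra scale (alia_bracket mult f g) (alia_coproduct scale \<delta> f g)"
proof -
  define D where "D = alia_coproduct scale \<delta> f g"
  define br where "br = alia_bracket mult f g"
  interpret A: left_alia_algebra scale br
    unfolding br_def by (rule left_alia_algebra_bracket[OF f g])
  interpret C: left_alia_coalgebra scale D
    unfolding D_def by (rule left_alia_coalgebra_coproduct[OF f g])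
  have "left_alia_bialgebra scale br D"
  proof
    fix x y
    have "tensor_flip scale (D (br x y - br y x)) \<beta> - D (br x y - br y x) \<beta>
      = (tensor_flip scale (tensor_map scale (\<lambda>z. br z y) id (D x) - tensor_map scale (\<lambda>z. br z x) id (D y))
          - (tensor_map scale (\<lambda>z. br z y) id (D x) - tensor_map scale (\<lambda>z. br z x) id (D y))) \<beta>"
      for \<beta>
    proof (cases "bilinear_map scale (*) \<beta>")
      case True
      then have "bilinear_map scale (*) (\<lambda>a b. \<beta> b a)"
        by (simp add: bilinear_form_iff)
      then show ?thesis
        using True alia_compat_form[OF f g True, of x y]
        by (simp add: tensor_flip_def tensor_map_def sweedler2_def tensor2_def D_def br_def)
    next
      case False
      have "tensor2 scale a b \<beta> = 0" "tensor2 scale a b (\<lambda>x y. 0) = 0" for a b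
        using False by (simp_all add: tensor2_def)
      then show ?thesis
        by (simp add: tensor_flip_def tensor_map_def sweedler2_def C.coproduct_zero_form
            tensor2_space_not_bilinear[OF C.coproduct_in_tensor2 False])
    qed
    then show "let d = \<lambda>t. tensor_flip scale t - t
      in d (D (br x y - br y x))
       = d (tensor_map scale (\<lambda>z. br z y) id (D x) - tensor_map scale (\<lambda>z. br z x) id (D y))"
      unfolding Let_def by (intro ext) simp
  qed
  then show ?thesis unfolding D_def br_def .
qed

end

theorem corollary4p3:
  fixes scale :: "'k::field_char_0 \<Rightarrow> 'a::ab_group_add \<Rightarrow> 'a"
    and mult :: "'a \<Rightarrow> 'a \<Rightarrow> 'a"
    and \<delta> :: "'a \<Rightarrow> ('a, 'k) tens2"
    and f g :: "'a \<Rightarrow> 'a"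
  assumes "comm_cocomm_assoc_D_bialgebra scale mult \<delta>"
    and "Vector_Spaces.linear scale scale f"
    and "Vector_Spaces.linear scale scale g"
  shows "left_alia_bialgebra scale
           (\<lambda>x y. mult x (f y) + g (mult x y))
           (\<lambda>x. sweedler2 (\<lambda>x1 x2. tensor2 scale x1 (g x2)) (\<delta> x) + \<delta> (f x))"
proof -
  have "alia_bracket mult f g = (\<lambda>x y. mult x (f y) + g (mult x y))"
    by (intro ext) (rule alia_bracket_def)
  moreover have "alia_coproduct scale \<delta> f g
      = (\<lambda>x. sweedler2 (\<lambda>x1 x2. tensor2 scale x1 (g x2)) (\<delta> x) + \<delta> (f x))"
    by (intro ext) (simp only: alia_coproduct_def)
  ultimately show ?thesis
    using comm_cocomm_assoc_D_bialgebra.left_alia_bialgebra_alia[OF assms] by (simp only:)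
qed

end
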